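(* Let $\mathcal{D}_{n,s}$ be an orthogonally structured positive basis of $\mathbb{R}^n$ and let $\mathcal{D}_{\mathbb{L}_1},\dots,\mathcal{D}_{\mathbb{L}_s}$ be a decomposition of $\mathcal{D}_{n,s}$ into minimal positive bases. Let $\mathcal{B}_n$ be a linear basis contained in $\mathcal{D}_{n,s}$ such that $\mathcal{B}_n=\bigcup_{i=1}^s\mathcal{B}_{\mathbb{L}_i}$, where every $\mathcal{B}_{\mathbb{L}_i}$ is a linear basis of the subspace $\mathbb{L}_i$ corresponding to $\mathcal{D}_{\mathbb{L}_i}$. For each basis $\mathcal{B}_{\mathbb{L}_i}$, define $$\gamma_{\mathcal{B}_{\mathbb{L}_i}}=\frac{1}{\sqrt{\mathbf{1}_{\mathbb{L}_i}^\top\mathbf{G}(\mathbf{B}_{\mathbb{L}_i})^{-1}\mathbf{1}_{\mathbb{L}_i}}},$$ where $\mathbf{B}_{\mathbb{L}_i}$ is a matrix representation of $\mathcal{B}_{\mathbb{L}_i}$ and $\mathbf{1}_{\mathbb{L}_i}$ denotes the all-ones vector in $\mathbb{R}^{\dim(\mathbb{L}_i)}$. Then $$\gamma_{\mathcal{B}_n}=\frac{1}{\sqrt{\sum_{i=1}^s\gamma_{\mathcal{B}_{\mathbb{L}_i}}^{-2}}}=\frac{1}{\sqrt{\sum_{i=1}^s\mathbf{1}_{\mathbb{L}_i}^\top\mathbf{G}(\mathbf{B}_{\mathbb{L}_i})^{-1}\mathbf{1}_{\mathbb{L}_i}}}.$$ As a result, the cosine measure and cosine vector set of $\mathcal{D}_{n,s}$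 are given respectively by $$\mathrm{cm}(\mathcal{D}_{n,s})=\frac{1}{\sqrt{\sum_{i=1}^s\max_{\mathbf{d}_i\in\mathcal{D}_{\mathbb{L}_i}}\gamma_{\mathcal{D}_{\mathbb{L}_i}\setminus\{\mathbf{d}_i\}}^{-2}}}$$ and $$c\mathcal{V}(\mathcal{D}_{n,s})=\left\{\mathbf{u}_{\mathcal{B}_n}:\ \mathcal{B}_n=\bigcup_{i=1}^s\mathcal{B}_{\mathbb{L}_i},\quad \mathbf{u}_{\mathcal{B}_n}=\frac{[\mathbf{B}_{\mathbb{L}_1}\ \cdots\ \mathbf{B}_{\mathbb{L}_s}]^{-\top}\mathbf{1}_n}{\sqrt{\sum_{i=1}^s\gamma_{\mathcal{B}_{\mathbb{L}_i}}^{-2}}}\right\}.$$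
   Context: Throughout, $n\ge2$. Families of vectors may contain repetitions; positive spanning sets are finite families of nonzero vectors. For a linear subspace $\mathbb{L}$ of $\mathbb{R}^n$ and a finite family $\mathcal{D}$ in $\mathbb{L}$, $\mathrm{pspan}(\mathcal{D})$ is the set of all linear combinations of elements of $\mathcal{D}$ with nonnegative coefficients; $\mathcal{D}$ is a positive spanning set of $\mathbb{L}$ if $\mathrm{pspan}(\mathcal{D})=\mathbb{L}$. A positive basis of $\mathbb{L}$ is a positive spanning set $\mathcal{D}$ of $\mathbb{L}$ such that $\mathrm{pspan}(\mathcal{D}\setminus\{\mathbf{d}\})\neq\mathbb{L}$ for every $\mathbf{d}\in\mathcal{D}$ (where $\mathcal{D}\setminus\{\mathbf{d}\}$ removes exactly one instance of $\mathbf{d}$). It is minimal if it has exactly $\dim(\mathbb{L})+1$ elements (with $\dim\mathbb{L}\ge1$). A positive basis $\mathcal{D}_{n,s}$ of $\mathbb{R}^n$ with $n+s$ elements is an orthogonally structured positive basis (OSPB) if there exist pairwise orthogonal subspaces $\mathbb{L}_1,\dots,\mathbb{L}_s$ of $\mathbb{R}^n$ with $\mathbb{R}^n=\mathbb{L}_1+\cdots+\mathbb{L}_s$ and minimal positive bases $\mathcal{D}_{\mathbb{L}_i}$ of $\mathbb{L}_i$ such that $\mathcal{D}_{n,s}=\mathcal{D}_{\mathbb{L}_1}\cup\cdots\cup\mathcal{D}_{\mathbb{L}_s}$; such a family $\mathcal{D}_{\mathbb{L}_1},\dots,\mathcal{D}_{\mathbb{L}_s}$ is a decomposition of $\mathcal{D}_{n,s}$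 into minimal positive bases. A matrix representation of a finite family of vectors in $\mathbb{R}^n$ is a matrix with $n$ rows whose columns are the elements of the family, in no particular order. For a matrix $\mathbf{S}$, $\mathbf{G}(\mathbf{S})=\mathbf{S}^\top\mathbf{S}$ is the associated Gram matrix. The vector $\mathbf{1}_n$ is the all-ones vector of $\mathbb{R}^n$. For a linear basis $\mathcal{B}$ of $\mathbb{R}^n$ contained in a positive spanning set of $\mathbb{R}^n$, with matrix representation $\mathbf{B}$, set $$\gamma_{\mathcal{B}}=\frac{1}{\sqrt{\mathbf{1}_n^\top\mathbf{G}(\mathbf{B})^{-1}\mathbf{1}_n}},\qquad \mathbf{u}_{\mathcal{B}}=\gamma_{\mathcal{B}}\mathbf{B}^{-\top}\mathbf{1}_n.$$ For a nonempty finite family $\mathcal{D}$ of nonzero vectors in $\mathbb{R}^n$, the cosine measure is $$\mathrm{cm}(\mathcal{D})=\min_{\mathbf{u}\in\mathbb{R}^n,\ \|\mathbf{u}\|=1}\ \max_{\mathbf{d}\in\mathcal{D}}\frac{\mathbf{u}^\top\mathbf{d}}{\|\mathbf{d}\|},$$ and the cosine vector set $c\mathcal{V}(\mathcal{D})$ is the set of all unit vectors $\mathbf{u}\in\mathbb{R}^n$ attaining this minimum.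
   Formalization: The cm and cV formulas are stated for unit vectors, and for general families with the basis vectors normalized; the set in the cV formula is restricted to bases B_n with gamma_{B_n} = cm(D) (after normalization). The literal formulas are false without these. *)

theory Defs
  imports "HOL-Analysis.Analysis" "Jordan_Normal_Form.Gauss_Jordan_Elimination"
begin

text \<open>
  A finite family of vectors of \<open>real ^ 'n\<close>, possibly with repetitions, is a list. The order of
  a list carries no meaning: families are compared through their multisets, and removing one
  instance of \<open>d\<close> is \<^term>\<open>remove1 d\<close>. Ordering the family is what selects one of its matrix
  representations, so that a statement about all lists covers all matrix representations.
\<close>

section \<open>Positive bases\<close>

definition pspan :: "(real ^ 'n) list \<Rightarrow> (real ^ 'n) set" where
  "pspan D = {(\<Sum>k<length D. c k *\<^sub>R (D ! k)) | c :: nat \<Rightarrow> real. \<forall>k<length D. 0 \<le> c k}"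

definition positive_spanning_set :: "(real ^ 'n) set \<Rightarrow> (real ^ 'n) list \<Rightarrow> bool" where
  "positive_spanning_set L D \<longleftrightarrow> set D \<subseteq> L \<and> 0 \<notin> set D \<and> pspan D = L"

definition positive_basis :: "(real ^ 'n) set \<Rightarrow> (real ^ 'n) list \<Rightarrow> bool" where
  "positive_basis L D \<longleftrightarrow>
     positive_spanning_set L D \<and> (\<forall>d\<in>set D. pspan (remove1 d D) \<noteq> L)"

definition minimal_positive_basis :: "(real ^ 'n) set \<Rightarrow> (real ^ 'n) list \<Rightarrow> bool" where
  "minimal_positive_basis L D \<longleftrightarrow> 1 \<le> dim L \<and> positive_basis L D \<and> length D = dim L + 1"

text \<open>The subspaces and the subfamilies are indexed by \<open>{0..<s}\<close>.\<close>

definition ospb_decomposition ::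
  "(real ^ 'n) list \<Rightarrow> nat \<Rightarrow> (nat \<Rightarrow> (real ^ 'n) set) \<Rightarrow> (nat \<Rightarrow> (real ^ 'n) list) \<Rightarrow> bool" where
  "ospb_decomposition D s L DL \<longleftrightarrow>
     (\<forall>i<s. subspace (L i)) \<and>
     (\<forall>i<s. \<forall>j<s. i \<noteq> j \<longrightarrow> (\<forall>x\<in>L i. \<forall>y\<in>L j. real_inner_class.orthogonal x y)) \<and>
     {(\<Sum>i<s. x i) | x. \<forall>i<s. x i \<in> L i} = UNIV \<and>
     (\<forall>i<s. minimal_positive_basis (L i) (DL i)) \<and>
     mset D = mset (concat (map DL [0..<s]))"

definition ospb :: "(real ^ 'n) list \<Rightarrow> nat \<Rightarrow> bool" where
  "ospb D s \<longleftrightarrow>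
     positive_basis UNIV D \<and> length D = CARD('n) + s \<and> (\<exists>L DL. ospb_decomposition D s L DL)"

section \<open>Linear bases\<close>

definition linear_basis :: "(real ^ 'n) set \<Rightarrow> (real ^ 'n) list \<Rightarrow> bool" where
  "linear_basis L B \<longleftrightarrow> distinct B \<and> independent (set B) \<and> span (set B) = L"

definition structured_basis ::
  "(real ^ 'n) list \<Rightarrow> nat \<Rightarrow> (nat \<Rightarrow> (real ^ 'n) set) \<Rightarrow> (nat \<Rightarrow> (real ^ 'n) list) \<Rightarrow>
   (real ^ 'n) list \<Rightarrow> bool" where
  "structured_basis D s L BL B \<longleftrightarrow>
     linear_basis UNIV B \<and> mset B \<subseteq># mset D \<and>
     (\<forall>i<s. linear_basis (L i) (BL i)) \<and>
     mset B = mset (concat (map BL [0..<s]))"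

section \<open>Matrices\<close>

text \<open>
  Dimensions of matrices vary with the subspaces, hence the matrices with explicit dimensions
  of \<open>Jordan_Normal_Form\<close>. Their rows are numbered from 0, whereas the coordinates of
  \<open>real ^ 'n\<close> are indexed by \<open>'n\<close>; \<open>coord\<close> is a fixed enumeration of these coordinates.
\<close>

definition coord :: "nat \<Rightarrow> 'n::finite" where
  "coord = (SOME f. bij_betw f {..<CARD('n)} (UNIV :: 'n set))"

definition vector_of_vec :: "real Matrix.vec \<Rightarrow> real ^ 'n" where
  "vector_of_vec v = vec_lambda (\<lambda>j. vec_index v (inv_into {..<CARD('n)} coord j))"

definition col_matrix :: "(real ^ 'n) list \<Rightarrow> real Matrix.mat" where
  "col_matrix S = Matrix.mat CARD('n) (length S) (\<lambda>(r, c). vec_nth (S ! c) (coord r))"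

definition gram :: "real Matrix.mat \<Rightarrow> real Matrix.mat" where
  "gram S = transpose_mat S * S"

definition inv_mat :: "real Matrix.mat \<Rightarrow> real Matrix.mat" where
  "inv_mat A = the (mat_inverse A)"

definition ones :: "nat \<Rightarrow> real Matrix.vec" where
  "ones k = Matrix.vec k (\<lambda>_. 1)"

definition ones_inv_gram_ones :: "(real ^ 'n) list \<Rightarrow> real" where
  "ones_inv_gram_ones B =
     scalar_prod (ones (length B)) (inv_mat (gram (col_matrix B)) *\<^sub>v ones (length B))"

definition gamma :: "(real ^ 'n) list \<Rightarrow> real" where
  "gamma B = 1 / sqrt (ones_inv_gram_ones B)"

text \<open>The vector \<open>B\<^sup>-\<^sup>T 1\<close>, meaningful when \<open>B\<close> is a linear basis of the whole space.\<close>

definition inv_transpose_ones :: "(real ^ 'n) list \<Rightarrow> real ^ 'n" where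
  "inv_transpose_ones B =
     vector_of_vec (inv_mat (transpose_mat (col_matrix B)) *\<^sub>v ones CARD('n))"

definition u_vec :: "(real ^ 'n) list \<Rightarrow> real ^ 'n" where
  "u_vec B = gamma B *\<^sub>R inv_transpose_ones B"

section \<open>Cosine measure\<close>

definition max_cosine :: "(real ^ 'n) list \<Rightarrow> real ^ 'n \<Rightarrow> real" where
  "max_cosine D u = Max ((\<lambda>d. inner u d / norm d) ` set D)"

text \<open>
  The vectors are normalized here but not in \<^term>\<open>gamma\<close> and \<^term>\<open>u_vec\<close>. Relating the two
  therefore requires families of unit vectors, or \<^term>\<open>map sgn\<close> applied to the bases, where
  \<open>sgn d = d /\<^sub>R norm d\<close>.

  The infimum is a minimum: for nonempty \<open>D\<close>, \<^term>\<open>max_cosine D\<close> is continuous and the unit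
  sphere is compact and nonempty.
\<close>

definition cosine_measure :: "(real ^ 'n) list \<Rightarrow> real" where
  "cosine_measure D = (INF u\<in>{u. norm u = 1}. max_cosine D u)"

definition cosine_vector_set :: "(real ^ 'n) list \<Rightarrow> (real ^ 'n) set" where
  "cosine_vector_set D = {u. norm u = 1 \<and> max_cosine D u = cosine_measure D}"

end

theory Submission
  imports Defs "Jordan_Normal_Form.Determinant"
begin

text \<open>
  The matrix expressions all encode one geometric object. For a linearly independent set \<open>E\<close>
  let \<open>w E\<close> be the vector of \<open>span E\<close> that has inner product 1 with every element of \<open>E\<close>
  (\<open>dual_ones\<close>). Solving the normal equations shows that \<open>1\<^sup>T G\<^sup>-\<^sup>1 1\<close> is the square of the norm
  of \<open>w E\<close>, so \<open>gamma\<close> is the reciprocal of this norm, and that \<open>B\<^sup>-\<^sup>T 1\<close> is \<open>w B\<close> itself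
  (\<open>ones_inv_gram_ones_eq\<close>, \<open>inv_transpose_ones_eq\<close>). If \<open>E\<close> is the union of sets that span
  pairwise orthogonal subspaces, then \<open>w E\<close> is the sum of the vectors of the pieces, and the theorem
  of Pythagoras turns this into the additivity of \<open>gamma\<^sup>-\<^sup>2\<close> (\<open>dual_ones_UN_orthogonal\<close>).

  For the cosine measure, let \<open>S\<close> be a minimal positive basis of \<open>L\<close>. Its elements satisfy a linear
  relation with positive coefficients, so removing any \<open>d\<close> leaves a linear basis of \<open>L\<close>, and
  sliding along the relation puts every vector of \<open>L\<close> into the cone of some \<open>S - {d}\<close>. Write \<open>w\<close>
  for the vector attached to the normalized elements of that \<open>S - {d}\<close>. If \<open>u\<close> lies in this cone
  and has inner product at most \<open>m\<close> with all normalized elements of \<open>S\<close>, then expanding one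
  factor of \<open>\<parallel>u\<parallel>\<^sup>2\<close> along the cone gives \<open>\<parallel>u\<parallel>\<^sup>2 \<le> m (u \<bullet> w)\<close>, which is the same as
  \<open>\<parallel>u - m w\<parallel>\<^sup>2 \<le> m\<^sup>2 \<parallel>w\<parallel>\<^sup>2 - \<parallel>u\<parallel>\<^sup>2\<close> (\<open>dist_facet_dual_le\<close>).

  Apply this to the components of a unit vector \<open>u\<close> in the orthogonal subspaces, with \<open>m\<close> the largest
  cosine between \<open>u\<close> and an element of \<open>D\<close>, and sum over the subspaces (\<open>dist_choice_dual_le\<close>).
  With \<open>W\<close> the sum of the \<open>w\<close> and \<open>M\<close> the sum over the subspaces of the largest possible
  \<open>\<parallel>w\<parallel>\<^sup>2\<close>, the result is \<open>\<parallel>u - m W\<parallel>\<^sup>2 \<le> m\<^sup>2 M - 1\<close>. Since \<open>m > 0\<close>,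
  nonnegativity of the left side yields \<open>m \<ge> 1 / sqrt M\<close>, and equality forces \<open>u = m W\<close>. Conversely \<open>W / \<parallel>W\<parallel>\<close> attains this
  bound whenever \<open>\<parallel>W\<parallel>\<^sup>2 = M\<close>, because the inner product of \<open>w\<close> with the normalized removed element
  is at most 0. Finally, the linear bases contained in \<open>D\<close> that split along the subspaces are exactly
  those obtained by removing one element from each minimal positive basis, so the vectors \<open>W\<close> are
  the vectors \<open>B\<^sup>-\<^sup>T 1\<close> of such bases after normalization. For a family of unit vectors normalization
  changes nothing, which gives the formulas without \<open>sgn\<close>.
\<close>

section \<open>The vector with inner product 1 with every element of a family\<close>

definition dual_ones :: "(real ^ 'n) set \<Rightarrow> real ^ 'n" where
  "dual_ones E = (THE w. w \<in> span E \<and> (\<forall>e\<in>E. inner w e = 1))"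

lemma dual_ones_unique:
  fixes E :: "(real ^ 'n) set"
  assumes w: "w \<in> span E" "\<And>e. e \<in> E \<Longrightarrow> inner w e = 1"
  shows "dual_ones E = w"
  unfolding dual_ones_def
proof (rule the_equality)
  fix v assume v: "v \<in> span E \<and> (\<forall>e\<in>E. inner v e = 1)"
  have "v - w \<in> span E"
    using v w by (simp add: span_diff)
  moreover have "real_inner_class.orthogonal (v - w) e" if "e \<in> E" for e
    using v w that by (simp add: real_inner_class.orthogonal_def inner_diff_left)
  ultimately have "real_inner_class.orthogonal (v - w) (v - w)"
    by (meson orthogonal_to_span)
  then show "v = w"
    by (simp add: real_inner_class.orthogonal_def)
qed (use w in auto)

text \<open>
  Existence: a linear functional equal to 1 on the independent set is represented by some vector, and
  the orthogonal projection of that vector onto the span has the same inner products with the set.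
\<close>

lemma dual_ones:
  fixes E :: "(real ^ 'n) set"
  assumes "independent E"
  shows "dual_ones E \<in> span E" and "e \<in> E \<Longrightarrow> inner (dual_ones E) e = 1"
proof -
  obtain f :: "real ^ 'n \<Rightarrow> real" where f: "linear f" "\<And>e. e \<in> E \<Longrightarrow> f e = 1"
    using linear_independent_extend[OF assms, of "\<lambda>_. 1"] by auto
  obtain w z where wz: "adjoint f 1 = w + z" "w \<in> span E"
    "\<And>y. y \<in> span E \<Longrightarrow> real_inner_class.orthogonal z y"
    using orthogonal_subspace_decomp_exists[of E "adjoint f 1"] by metis
  have "inner w e = 1" if "e \<in> E" for e
  proof -
    have "inner (adjoint f 1) e = f e"
      using adjoint_works[OF f(1), of e 1] by (simp add: inner_commute)
    then show ?thesis
      using wz(3)[OF span_base[OF that]] f(2)[OF that] wz(1)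
      by (simp add: real_inner_class.orthogonal_def inner_add_left)
  qed
  then have "dual_ones E = w"
    using wz(2) by (intro dual_ones_unique)
  then show "dual_ones E \<in> span E" and "e \<in> E \<Longrightarrow> inner (dual_ones E) e = 1"
    using wz(2) \<open>\<And>e. e \<in> E \<Longrightarrow> inner w e = 1\<close> by auto
qed

text \<open>
  The sum of the vectors of the pieces is characteristic for the union, since each summand is
  orthogonal to all pieces but its own. The second part is the source of the additivity of \<open>gamma\<^sup>-\<^sup>2\<close>.
\<close>

lemma dual_ones_UN_orthogonal:
  fixes E :: "nat \<Rightarrow> (real ^ 'n) set"
  assumes ind: "\<And>i. i < s \<Longrightarrow> independent (E i)"
    and orth: "\<And>i j x y. i < s \<Longrightarrow> j < s \<Longrightarrow> i \<noteq> j \<Longrightarrow> x \<in> span (E i) \<Longrightarrow> y \<in> span (E j) \<Longrightarrow>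
      real_inner_class.orthogonal x y"
  shows "dual_ones (\<Union>i<s. E i) = (\<Sum>i<s. dual_ones (E i))"
    and "(norm (dual_ones (\<Union>i<s. E i)))\<^sup>2 = (\<Sum>i<s. (norm (dual_ones (E i)))\<^sup>2)"
proof -
  show eq: "dual_ones (\<Union>i<s. E i) = (\<Sum>i<s. dual_ones (E i))"
  proof (rule dual_ones_unique)
    have "dual_ones (E i) \<in> span (\<Union>i<s. E i)" if "i < s" for i
      using dual_ones(1)[OF ind[OF that]] span_mono[of "E i" "\<Union>i<s. E i"] that by blast
    then show "(\<Sum>i<s. dual_ones (E i)) \<in> span (\<Union>i<s. E i)"
      by (intro span_sum) auto
  next
    fix e assume "e \<in> (\<Union>i<s. E i)"
    then obtain j where j: "j < s" "e \<in> E j"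
      by auto
    have "inner (dual_ones (E i)) e = (if i = j then 1 else 0)" if "i < s" for i
      using dual_ones(2)[OF ind[OF \<open>j < s\<close>] j(2)]
        orth[OF that j(1) _ dual_ones(1)[OF ind[OF that]] span_base[OF j(2)]]
      by (auto simp: real_inner_class.orthogonal_def)
    then show "inner (\<Sum>i<s. dual_ones (E i)) e = 1"
      using j(1) by (simp add: inner_sum_left)
  qed
  show "(norm (dual_ones (\<Union>i<s. E i)))\<^sup>2 = (\<Sum>i<s. (norm (dual_ones (E i)))\<^sup>2)"
    unfolding eq
  proof (rule norm_sum_Pythagorean)
    show "pairwise (\<lambda>i j. real_inner_class.orthogonal (dual_ones (E i)) (dual_ones (E j))) {..<s}"
      unfolding pairwise_def using orth dual_ones(1) ind by (metis lessThan_iff)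
  qed simp
qed

section \<open>Matrices\<close>

lemma coord_bij: "bij_betw (coord :: nat \<Rightarrow> 'n) {..<CARD('n)} (UNIV :: 'n::finite set)"
proof -
  have "\<exists>f. bij_betw f {..<CARD('n)} (UNIV :: 'n set)"
    using ex_bij_betw_nat_finite[of "UNIV :: 'n set"] by (simp add: lessThan_atLeast0)
  then show ?thesis
    unfolding coord_def by (rule someI_ex)
qed

lemma sum_coord: "(\<Sum>r<CARD('n). f (coord r)) = (\<Sum>j\<in>(UNIV :: 'n::finite set). f j)"
  using sum.reindex_bij_betw[OF coord_bij, of f] .

lemma vector_of_vec_coord:
  assumes "r < CARD('n)"
  shows "vec_nth (vector_of_vec v :: real ^ 'n) (coord r) = vec_index v r"
  using assms coord_bij[where 'n = 'n]
  by (simp add: vector_of_vec_def inv_into_f_f bij_betw_def)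

lemma inner_vector_of_vec:
  fixes d :: "real ^ 'n"
  shows "inner (vector_of_vec v) d = (\<Sum>r<CARD('n). vec_index v r * vec_nth d (coord r))"
proof -
  have "inner (vector_of_vec v) d =
      (\<Sum>r<CARD('n). vec_nth (vector_of_vec v :: real ^ 'n) (coord r) * vec_nth d (coord r))"
    by (simp add: inner_vec_def sum_coord[of "\<lambda>j. vec_nth (vector_of_vec v :: real ^ 'n) j * vec_nth d j"])
  then show ?thesis
    by (simp add: vector_of_vec_coord)
qed

lemma col_matrix_carrier: "col_matrix (B :: (real ^ 'n) list) \<in> carrier_mat CARD('n) (length B)"
  by (simp add: col_matrix_def)

lemma transpose_col_matrix_mult:
  fixes B :: "(real ^ 'n) list"
  assumes "v \<in> carrier_vec CARD('n)"
  shows "transpose_mat (col_matrix B) *\<^sub>v v =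
    Matrix.vec (length B) (\<lambda>k. inner (vector_of_vec v) (B ! k))"
  using assms
  by (intro eq_vecI)
    (auto simp: col_matrix_def scalar_prod_def inner_vector_of_vec mult.commute lessThan_atLeast0
      intro!: sum.cong)

text \<open>
  Multiplying by the Gram matrix lists the inner products of a linear combination with the family:
  the equation \<open>G c = 1\<close> says that \<open>c\<close> holds the coefficients of \<open>dual_ones\<close>.
\<close>

lemma gram_mult:
  fixes B :: "(real ^ 'n) list"
  assumes "c \<in> carrier_vec (length B)"
  shows "gram (col_matrix B) *\<^sub>v c =
    Matrix.vec (length B) (\<lambda>k. inner (\<Sum>j<length B. vec_index c j *\<^sub>R B ! j) (B ! k))"
proof -
  have dim: "col_matrix B *\<^sub>v c \<in> carrier_vec CARD('n)"
    using col_matrix_carrier[of B] assms by (simp add: mult_mat_vec_carrier)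
  have entry: "vec_index (col_matrix B *\<^sub>v c) r =
      vec_nth (\<Sum>j<length B. vec_index c j *\<^sub>R B ! j) (coord r)" if "r < CARD('n)" for r
    using that assms
    by (auto simp: col_matrix_def scalar_prod_def lessThan_atLeast0 mult.commute intro!: sum.cong)
  have "(vector_of_vec (col_matrix B *\<^sub>v c) :: real ^ 'n) = (\<Sum>j<length B. vec_index c j *\<^sub>R B ! j)"
  proof (rule iffD2[OF Finite_Cartesian_Product.vec_eq_iff], rule allI)
    fix i :: 'n
    obtain r where "r < CARD('n)" "i = coord r"
      using coord_bij[where 'n = 'n] unfolding bij_betw_def by blast
    then show "vec_nth (vector_of_vec (col_matrix B *\<^sub>v c) :: real ^ 'n) i =
        vec_nth (\<Sum>j<length B. vec_index c j *\<^sub>R B ! j) i"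
      using vector_of_vec_coord[where 'n = 'n, of r] entry by metis
  qed
  moreover have "gram (col_matrix B) *\<^sub>v c = transpose_mat (col_matrix B) *\<^sub>v (col_matrix B *\<^sub>v c)"
    unfolding gram_def using col_matrix_carrier[of B] assms
    by (intro assoc_mult_mat_vec) auto
  ultimately show ?thesis
    using transpose_col_matrix_mult[OF dim] by simp
qed

lemma ones_carrier: "ones k \<in> carrier_vec k"
  by (simp add: ones_def)

text \<open>
  A square matrix with trivial kernel is invertible, so \<open>inv_mat\<close>, which is unspecified for singular
  matrices, solves the linear system.
\<close>

lemma mult_inv_mat_mult:
  fixes A :: "real mat"
  assumes A: "A \<in> carrier_mat k k" and b: "b \<in> carrier_vec k"
    and ker: "\<And>v. v \<in> carrier_vec k \<Longrightarrow> A *\<^sub>v v = 0\<^sub>v k \<Longrightarrow> v = 0\<^sub>v k"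
  shows "inv_mat A *\<^sub>v b \<in> carrier_vec k" and "A *\<^sub>v (inv_mat A *\<^sub>v b) = b"
proof -
  have "Determinant.det A \<noteq> 0"
    using ker by (auto simp: det_0_iff_vec_prod_zero_field[OF A])
  then have "A \<in> Units (ring_mat TYPE(real) k ())"
    by (rule det_non_zero_imp_unit[OF A])
  then obtain A' where A': "mat_inverse A = Some A'"
    using mat_inverse(1)[OF A, of "()"] by (cases "mat_inverse A") auto
  have inv: "A * A' = 1\<^sub>m k" "A' \<in> carrier_mat k k"
    using mat_inverse(2)[OF A A'] by auto
  have eq: "inv_mat A = A'"
    by (simp add: inv_mat_def A')
  show "inv_mat A *\<^sub>v b \<in> carrier_vec k"
    unfolding eq using inv(2) b by (rule mult_mat_vec_carrier)
  show "A *\<^sub>v (inv_mat A *\<^sub>v b) = b"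
    unfolding eq using assoc_mult_mat_vec[OF A inv(2) b] inv(1) b by simp
qed

lemma sum_nth_distinct:
  assumes "distinct xs"
  shows "(\<Sum>k<length xs. f (xs ! k)) = sum f (set xs)"
  using sum.reindex_bij_betw[OF bij_betw_nth[OF assms refl refl], of f] .

lemma nth_sum_eq_0_imp:
  fixes B :: "(real ^ 'n) list"
  assumes "distinct B" "independent (set B)" "(\<Sum>j<length B. c j *\<^sub>R B ! j) = 0" "k < length B"
  shows "c k = 0"
proof -
  define idx where "idx = inv_into {..<length B} (\<lambda>k. B ! k)"
  have idx: "idx (B ! j) = j" if "j < length B" for j
    using assms(1) that unfolding idx_def
    by (intro inv_into_f_f) (auto simp: inj_on_def nth_eq_iff_index_eq)
  have "(\<Sum>j<length B. c j *\<^sub>R B ! j) = (\<Sum>j<length B. c (idx (B ! j)) *\<^sub>R B ! j)"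
    by (intro sum.cong) (auto simp: idx)
  also have "\<dots> = (\<Sum>b\<in>set B. c (idx b) *\<^sub>R b)"
    by (rule sum_nth_distinct[OF assms(1)])
  finally have "(\<Sum>b\<in>set B. c (idx b) *\<^sub>R b) = 0"
    using assms(3) by simp
  then have "c (idx (B ! k)) = 0"
    using independentD[OF assms(2) finite_set subset_refl, of "\<lambda>b. c (idx b)" "B ! k"] assms(4)
    by simp
  then show ?thesis
    by (simp only: idx assms(4))
qed

text \<open>
  With \<open>c = G\<^sup>-\<^sup>1 1\<close> and \<open>w = B c\<close>, the sum of the entries of \<open>c\<close> is \<open>w \<bullet> w\<close>, because every column
  of \<open>B\<close> has inner product 1 with \<open>w\<close>.
\<close>

lemma ones_inv_gram_ones_eq:
  fixes B :: "(real ^ 'n) list"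
  assumes "distinct B" "independent (set B)"
  shows "ones_inv_gram_ones B = (norm (dual_ones (set B)))\<^sup>2"
proof -
  let ?k = "length B" and ?G = "gram (col_matrix B)"
  let ?comb = "\<lambda>c. \<Sum>j<?k. vec_index c j *\<^sub>R B ! j"
  have G: "?G \<in> carrier_mat ?k ?k"
    using col_matrix_carrier[of B] by (simp add: gram_def)
  have comb_span: "?comb c \<in> span (set B)" for c
    by (intro span_sum span_scale span_base) simp
  have ker: "c = 0\<^sub>v ?k" if c: "c \<in> carrier_vec ?k" "?G *\<^sub>v c = 0\<^sub>v ?k" for c
  proof -
    have "inner (?comb c) (B ! k) = 0" if "k < ?k" for k
      using arg_cong[OF c(2), of "\<lambda>v. vec_index v k"] gram_mult[OF c(1)] that by simp
    then have "real_inner_class.orthogonal (?comb c) b" if "b \<in> set B" for b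
      using that by (auto simp: real_inner_class.orthogonal_def in_set_conv_nth)
    then have "real_inner_class.orthogonal (?comb c) (?comb c)"
      using comb_span[of c] by (meson orthogonal_to_span)
    then have "?comb c = 0"
      by (simp add: real_inner_class.orthogonal_def)
    then have "vec_index c k = 0" if "k < ?k" for k
      using that by (rule nth_sum_eq_0_imp[OF assms])
    then show ?thesis
      using c(1) by (intro eq_vecI) auto
  qed
  define c where "c = inv_mat ?G *\<^sub>v ones ?k"
  have c: "c \<in> carrier_vec ?k" "?G *\<^sub>v c = ones ?k"
    unfolding c_def by (rule mult_inv_mat_mult[OF G ones_carrier ker]; assumption)+
  have inn: "inner (?comb c) (B ! k) = 1" if "k < ?k" for k
    using arg_cong[OF c(2), of "\<lambda>v. vec_index v k"] gram_mult[OF c(1)] that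
    by (simp add: ones_def)
  have "inner (?comb c) b = 1" if "b \<in> set B" for b
    using that inn unfolding in_set_conv_nth by blast
  then have w: "dual_ones (set B) = ?comb c"
    by (rule dual_ones_unique[OF comb_span])
  have "ones_inv_gram_ones B = (\<Sum>k<?k. vec_index c k)"
    unfolding ones_inv_gram_ones_def c_def[symmetric] using c(1)
    by (simp add: scalar_prod_def ones_def lessThan_atLeast0)
  also have "\<dots> = (\<Sum>k<?k. vec_index c k * inner (?comb c) (B ! k))"
    by (intro sum.cong refl) (simp only: inn lessThan_iff mult_1_right)
  also have "\<dots> = inner (?comb c) (?comb c)"
    unfolding inner_sum_right[of "?comb c"] inner_scaleR_right ..
  finally show ?thesis
    by (simp only: w power2_norm_eq_inner)
qed

lemma inv_transpose_ones_eq: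
  fixes B :: "(real ^ 'n) list"
  assumes "linear_basis UNIV B"
  shows "inv_transpose_ones B = dual_ones (set B)"
proof -
  have B: "distinct B" "independent (set B)" "span (set B) = UNIV"
    using assms by (auto simp: linear_basis_def)
  have len: "length B = CARD('n)"
    using dim_eq_card_independent[OF B(2)] dim_span[of "set B"] B(1,3)
    by (simp add: distinct_card)
  let ?T = "transpose_mat (col_matrix B)"
  have T: "?T \<in> carrier_mat CARD('n) CARD('n)"
    using col_matrix_carrier[of B] len by simp
  have ker: "v = 0\<^sub>v CARD('n)" if v: "v \<in> carrier_vec CARD('n)" "?T *\<^sub>v v = 0\<^sub>v CARD('n)" for v
  proof -
    have "inner (vector_of_vec v) (B ! k) = 0" if "k < CARD('n)" for k
      using arg_cong[OF v(2), of "\<lambda>v. vec_index v k"] transpose_col_matrix_mult[OF v(1), of B] that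
      by (simp add: len)
    then have "real_inner_class.orthogonal (vector_of_vec v) b" if "b \<in> set B" for b
      using that by (auto simp: real_inner_class.orthogonal_def in_set_conv_nth len)
    then have "real_inner_class.orthogonal (vector_of_vec v :: real ^ 'n) (vector_of_vec v)"
      using B(3) by (metis UNIV_I orthogonal_to_span)
    then have "(vector_of_vec v :: real ^ 'n) = 0"
      by (simp add: real_inner_class.orthogonal_def)
    then have "vec_index v r = 0" if "r < CARD('n)" for r
      using vector_of_vec_coord[where 'n = 'n, OF that, of v] by simp
    then show ?thesis
      using v(1) by (intro eq_vecI) auto
  qed
  define y where "y = inv_mat ?T *\<^sub>v ones CARD('n)"
  have y: "y \<in> carrier_vec CARD('n)" "?T *\<^sub>v y = ones CARD('n)"
    unfolding y_def by (rule mult_inv_mat_mult[OF T ones_carrier ker]; assumption)+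
  have "inner (vector_of_vec y) (B ! k) = 1" if "k < length B" for k
    using arg_cong[OF y(2), of "\<lambda>v. vec_index v k"] transpose_col_matrix_mult[OF y(1), of B] that len
    by (simp add: ones_def)
  then have "inner (vector_of_vec y) b = 1" if "b \<in> set B" for b
    using that unfolding in_set_conv_nth by blast
  then have "dual_ones (set B) = vector_of_vec y"
    using dual_ones_unique[of "vector_of_vec y" "set B"] B(3) by simp
  then show ?thesis
    unfolding inv_transpose_ones_def y_def by (rule sym)
qed

lemma gamma_eq:
  assumes "distinct B" "independent (set B)"
  shows "gamma B = 1 / norm (dual_ones (set B))"
    and "gamma B powi (-2) = (norm (dual_ones (set B)))\<^sup>2"
  by (simp_all add: gamma_def ones_inv_gram_ones_eq[OF assms] power_int_def)

section \<open>Bases and normalization\<close>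

lemma span_sgn_image:
  fixes E :: "(real ^ 'n) set"
  assumes "finite E" "0 \<notin> E"
  shows "span (sgn ` E) = span E"
proof -
  have "span ((\<lambda>x. inverse (norm x) *\<^sub>R x) ` E) = span E"
    using assms by (intro real_vector.span_image_scale) auto
  moreover have "(\<lambda>x. inverse (norm x) *\<^sub>R x) ` E = sgn ` E"
    by (simp add: sgn_div_norm)
  ultimately show ?thesis
    by simp
qed

text \<open>
  Normalizing keeps the span, so the image needs as many elements as the original set: this gives
  independence and injectivity at once.
\<close>

lemma independent_sgn_image:
  fixes E :: "(real ^ 'n) set"
  assumes "independent E"
  shows "independent (sgn ` E)" and "inj_on sgn E"
proof -
  have fin: "finite E" and nz: "0 \<notin> E"
    using assms independent_imp_finite dependent_zero by auto
  have span: "span (sgn ` E) = span E"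
    by (rule span_sgn_image[OF fin nz])
  have dim: "dim (span (sgn ` E)) = card E"
    unfolding span using dim_span[of E] dim_eq_card_independent[OF assms] by simp
  have le: "card (sgn ` E) \<le> card E"
    by (rule card_image_le[OF fin])
  show "independent (sgn ` E)"
  proof (rule card_le_dim_spanning)
    show "sgn ` E \<subseteq> span (sgn ` E)"
      by (rule span_superset)
  qed (use fin dim le in auto)
  have "dim (span (sgn ` E)) \<le> card (sgn ` E)"
    by (rule dim_le_card) (use fin in auto)
  then show "inj_on sgn E"
    using le dim fin by (intro eq_card_imp_inj_on) auto
qed

lemma linear_basis_map_sgn:
  fixes B :: "(real ^ 'n) list"
  assumes "linear_basis L B"
  shows "linear_basis L (map sgn B)"
proof -
  have B: "distinct B" "independent (set B)" "span (set B) = L"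
    using assms by (auto simp: linear_basis_def)
  have "0 \<notin> set B"
    using B(2) dependent_zero by auto
  then show ?thesis
    using B independent_sgn_image[OF B(2)] span_sgn_image[of "set B"]
    by (simp add: linear_basis_def distinct_map)
qed

text \<open>
  A list that spans a subspace and is no longer than its dimension cannot contain repetitions.
\<close>

lemma linear_basis_of_spanning:
  fixes B :: "(real ^ 'n) list"
  assumes "set B \<subseteq> L" "L \<subseteq> span (set B)" "subspace L" "length B \<le> dim L"
  shows "linear_basis L B"
proof -
  have card: "dim L \<le> card (set B)"
    using assms(2) by (intro dim_le_card) auto
  then have "distinct B"
    using assms(4) card_length[of B] by (intro card_distinct) simp
  moreover have "independent (set B)"
    using assms card_length[of B] by (intro card_le_dim_spanning[of _ L]) auto
  moreover have "span (set B) = L"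
    using assms(1-3) span_minimal by blast
  ultimately show ?thesis
    by (simp add: linear_basis_def)
qed

lemma linear_basis_length:
  fixes B :: "(real ^ 'n) list"
  assumes "linear_basis L B"
  shows "length B = dim L"
proof -
  have B: "distinct B" "independent (set B)" "span (set B) = L"
    using assms by (auto simp: linear_basis_def)
  show ?thesis
    using dim_eq_card_independent[OF B(2)] dim_span[of "set B"] distinct_card[OF B(1)] B(3) by simp
qed

text \<open>
  Coefficients of equal list entries add up, so that sums over the set suffice.
\<close>

lemma pspan_elim:
  fixes D :: "(real ^ 'n) list"
  assumes "u \<in> pspan D"
  obtains c where "\<And>d. d \<in> set D \<Longrightarrow> 0 \<le> c d" "u = (\<Sum>d\<in>set D. c d *\<^sub>R d)"
proof -
  obtain a where a: "\<And>k. k < length D \<Longrightarrow> 0 \<le> a k" "u = (\<Sum>k<length D. a k *\<^sub>R D ! k)"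
    using assms unfolding pspan_def by blast
  define c where "c d = (\<Sum>k | k \<in> {..<length D} \<and> D ! k = d. a k)" for d
  have "(\<Sum>d\<in>set D. c d *\<^sub>R d) =
      (\<Sum>d\<in>set D. \<Sum>k | k \<in> {..<length D} \<and> D ! k = d. a k *\<^sub>R D ! k)"
    unfolding c_def scaleR_left.sum by (intro sum.cong) auto
  also have "\<dots> = u"
    unfolding a(2) by (intro sum.group) auto
  finally have "u = (\<Sum>d\<in>set D. c d *\<^sub>R d)" ..
  moreover have "0 \<le> c d" for d
    unfolding c_def by (intro sum_nonneg) (use a(1) in auto)
  ultimately show ?thesis
    by (intro that)
qed

section \<open>Minimal positive bases of a subspace\<close>

text \<open>
  The properties of a minimal positive basis that matter here, for the underlying set. The bound on the
  cardinality is an inequality, so that it can be verified for the entries of a list before these are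
  known to be distinct; equality and distinctness follow.
\<close>

locale simplicial_family =
  fixes L S :: "(real ^ 'n) set"
  assumes subspace: "subspace L"
    and finite: "finite S"
    and nonempty: "S \<noteq> {}"
    and nonzero: "0 \<notin> S"
    and subset: "S \<subseteq> L"
    and card_le: "card S \<le> dim L + 1"
    and nonneg_comb: "u \<in> L \<Longrightarrow> \<exists>c. (\<forall>d\<in>S. 0 \<le> c d) \<and> u = (\<Sum>d\<in>S. c d *\<^sub>R d)"
begin

text \<open>
  Adding all elements to a nonnegative combination for minus their sum makes every coefficient at
  least 1.
\<close>

lemma positive_relation:
  obtains l where "\<And>d. d \<in> S \<Longrightarrow> 0 < l d" "(\<Sum>d\<in>S. l d *\<^sub>R d) = 0"
proof -
  have "- (\<Sum>d\<in>S. d) \<in> L"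
    using subset by (intro subspace_neg subspace_sum subspace) auto
  then obtain c where c: "\<forall>d\<in>S. 0 \<le> c d" "- (\<Sum>d\<in>S. d) = (\<Sum>d\<in>S. c d *\<^sub>R d)"
    using nonneg_comb by blast
  have "(\<Sum>d\<in>S. (1 + c d) *\<^sub>R d) = (\<Sum>d\<in>S. d) + (\<Sum>d\<in>S. c d *\<^sub>R d)"
    by (simp add: scaleR_left_distrib sum.distrib)
  also have "\<dots> = 0"
    unfolding c(2)[symmetric] by simp
  finally show ?thesis
    using c(1) by (intro that[of "\<lambda>d. 1 + c d"]) (auto simp: add_pos_nonneg)
qed

text \<open>
  The positive relation expresses \<open>d\<close> by the other elements.
\<close>

lemma span_facet:
  assumes "d \<in> S"
  shows "span (S - {d}) = L"
proof -
  obtain l where l: "\<And>e. e \<in> S \<Longrightarrow> 0 < l e" "(\<Sum>e\<in>S. l e *\<^sub>R e) = 0"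
    by (rule positive_relation) blast
  have "l d *\<^sub>R d + (\<Sum>e\<in>S - {d}. l e *\<^sub>R e) = 0"
    using sum.remove[OF finite assms, of "\<lambda>e. l e *\<^sub>R e"] l(2) by simp
  then have eq: "l d *\<^sub>R d = - (\<Sum>e\<in>S - {d}. l e *\<^sub>R e)"
    by (rule eq_neg_iff_add_eq_0[THEN iffD2])
  have "d = inverse (l d) *\<^sub>R (l d *\<^sub>R d)"
    using l(1)[OF assms] by simp
  also have "\<dots> = inverse (l d) *\<^sub>R - (\<Sum>e\<in>S - {d}. l e *\<^sub>R e)"
    by (simp only: eq)
  also have "\<dots> \<in> span (S - {d})"
    by (intro span_scale span_neg span_sum span_base)
  finally have "d \<in> span (S - {d})" .
  then have "S \<subseteq> span (S - {d})"
    using span_superset[of "S - {d}"] by blast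
  have "u \<in> span (S - {d})" if "u \<in> L" for u
  proof -
    obtain c where "u = (\<Sum>e\<in>S. c e *\<^sub>R e)"
      using nonneg_comb[OF \<open>u \<in> L\<close>] by blast
    then show ?thesis
      using \<open>S \<subseteq> span (S - {d})\<close>
      by (simp only:) (intro span_sum span_scale; blast)
  qed
  moreover have "span (S - {d}) \<subseteq> L"
    using subset by (intro span_minimal subspace) auto
  ultimately show ?thesis
    by blast
qed

lemma card_eq: "card S = dim L + 1"
proof -
  obtain d where d: "d \<in> S"
    using nonempty by blast
  have "dim L \<le> card (S - {d})"
    using span_facet[OF d] finite by (intro dim_le_card) auto
  moreover have "0 < card S"
    using finite d card_gt_0_iff by blast
  ultimately show ?thesis
    using card_le d finite by (simp add: card_Diff_singleton)
qed

lemma independent_facet: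
  assumes "d \<in> S"
  shows "independent (S - {d})"
proof (rule card_le_dim_spanning)
  show "S - {d} \<subseteq> L" "L \<subseteq> span (S - {d})" "finite (S - {d})"
    using subset span_facet[OF assms] finite by auto
  show "card (S - {d}) \<le> dim L"
    using card_eq assms finite by (simp add: card_Diff_singleton)
qed

text \<open>
  Subtract from a nonnegative representation the largest multiple of the positive relation that keeps
  all coefficients nonnegative: then some coefficient vanishes.
\<close>

lemma in_facet_cone:
  assumes "u \<in> L"
  obtains d c where "d \<in> S" "\<And>e. e \<in> S - {d} \<Longrightarrow> 0 \<le> c e" "u = (\<Sum>e\<in>S - {d}. c e *\<^sub>R e)"
proof -
  obtain l where l: "\<And>e. e \<in> S \<Longrightarrow> 0 < l e" "(\<Sum>e\<in>S. l e *\<^sub>R e) = 0"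
    by (rule positive_relation) blast
  obtain c where c: "\<forall>d\<in>S. 0 \<le> c d" "u = (\<Sum>d\<in>S. c d *\<^sub>R d)"
    using nonneg_comb[OF assms] by blast
  \<comment> \<open>The element whose coefficient reaches 0 first.\<close>
  define d where "d = arg_min_on (\<lambda>e. c e / l e) S"
  have d: "d \<in> S"
    unfolding d_def using finite nonempty by (rule arg_min_if_finite)
  have min: "c d / l d \<le> c e / l e" if "e \<in> S" for e
    unfolding d_def using finite nonempty that by (rule arg_min_least)
  define c' where "c' e = c e - c d / l d * l e" for e
  have "(\<Sum>e\<in>S. c' e *\<^sub>R e) = (\<Sum>e\<in>S. c e *\<^sub>R e) - (c d / l d) *\<^sub>R (\<Sum>e\<in>S. l e *\<^sub>R e)"
    by (simp add: c'_def scaleR_left_diff_distrib sum_subtractf scaleR_sum_right)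
  then have "u = (\<Sum>e\<in>S. c' e *\<^sub>R e)"
    by (simp add: c(2) l(2))
  moreover have "c' d = 0"
    using l(1)[OF d] by (simp add: c'_def)
  ultimately have "u = (\<Sum>e\<in>S - {d}. c' e *\<^sub>R e)"
    using sum.remove[OF finite d, of "\<lambda>e. c' e *\<^sub>R e"] by simp
  moreover have "0 \<le> c' e" if "e \<in> S - {d}" for e
    using min[of e] l(1)[of e] that by (simp add: c'_def pos_le_divide_eq)
  ultimately show ?thesis
    by (intro that[OF d])
qed

definition facet_dual :: "real ^ 'n \<Rightarrow> real ^ 'n" where
  "facet_dual d = dual_ones (sgn ` (S - {d}))"

lemma facet_dual_in: "d \<in> S \<Longrightarrow> facet_dual d \<in> L"
  unfolding facet_dual_def
  using dual_ones(1)[OF independent_sgn_image(1)[OF independent_facet]]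
    span_sgn_image[of "S - {d}"] span_facet finite nonzero by auto

lemma inner_facet_dual:
  assumes "d \<in> S" "e \<in> S - {d}"
  shows "inner (facet_dual d) (sgn e) = 1" and "inner (facet_dual d) e = norm e"
proof -
  show eq: "inner (facet_dual d) (sgn e) = 1"
    unfolding facet_dual_def
    using assms by (intro dual_ones(2) independent_sgn_image(1) independent_facet) auto
  then show "inner (facet_dual d) e = norm e"
    using assms nonzero by (auto simp: sgn_div_norm field_simps)
qed

text \<open>
  For the removed element \<open>d\<close> the inner product is even nonpositive: pairing the positive relation with
  the vector shows that a positive multiple of it plus a nonnegative sum is 0.
\<close>

lemma inner_facet_dual_le:
  assumes "d \<in> S" "e \<in> S"
  shows "inner (facet_dual d) (sgn e) \<le> 1"
proof (cases "e = d")
  case True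
  obtain l where l: "\<And>e. e \<in> S \<Longrightarrow> 0 < l e" "(\<Sum>e\<in>S. l e *\<^sub>R e) = 0"
    by (rule positive_relation) blast
  have "0 = inner (facet_dual d) (\<Sum>e\<in>S. l e *\<^sub>R e)"
    by (simp add: l(2))
  also have "\<dots> = l d * inner (facet_dual d) d + (\<Sum>e\<in>S - {d}. l e * inner (facet_dual d) e)"
    using sum.remove[OF finite assms(1), of "\<lambda>e. l e * inner (facet_dual d) e"]
    by (simp add: inner_sum_right)
  also have "(\<Sum>e\<in>S - {d}. l e * inner (facet_dual d) e) = (\<Sum>e\<in>S - {d}. l e * norm e)"
    by (intro sum.cong) (simp_all add: inner_facet_dual(2)[OF assms(1)])
  finally have "l d * inner (facet_dual d) d = - (\<Sum>e\<in>S - {d}. l e * norm e)"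
    by simp
  also have "\<dots> \<le> 0"
    using l(1) by (auto intro!: sum_nonneg mult_nonneg_nonneg intro: less_imp_le)
  finally have "inner (facet_dual d) d \<le> 0"
    using l(1)[OF assms(1)] by (simp add: mult_le_0_iff)
  then have "inner (facet_dual d) (sgn d) \<le> 0"
    by (simp add: sgn_div_norm mult_nonneg_nonpos)
  then show ?thesis
    using True by simp
next
  case False
  then show ?thesis
    using inner_facet_dual(1)[OF assms(1), of e] assms(2) by simp
qed

text \<open>
  The estimate behind both the value of the cosine measure and the equality case. Here \<open>d\<close> is an element
  such that \<open>u\<close> lies in the cone of the others, and \<open>k\<close> in the proof is \<open>u \<bullet> facet_dual d\<close>, which is
  also the total weight of the normalized generators in \<open>u\<close>. The last conclusion serves to show that
  the largest cosine of a unit vector is positive.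
\<close>

lemma dist_facet_dual_le:
  assumes u: "u \<in> L" and m: "\<And>e. e \<in> S \<Longrightarrow> inner u (sgn e) \<le> m"
  obtains d where "d \<in> S"
    "(norm (u - m *\<^sub>R facet_dual d))\<^sup>2 \<le> m\<^sup>2 * (norm (facet_dual d))\<^sup>2 - (norm u)\<^sup>2"
    "m \<le> 0 \<Longrightarrow> u = 0"
proof -
  obtain d c where d: "d \<in> S" "\<And>e. e \<in> S - {d} \<Longrightarrow> 0 \<le> c e" "u = (\<Sum>e\<in>S - {d}. c e *\<^sub>R e)"
    by (rule in_facet_cone[OF u]) blast
  let ?w = "facet_dual d"
  define k where "k = (\<Sum>e\<in>S - {d}. c e * norm e)"
  have "0 \<le> k"
    unfolding k_def using d(2) by (intro sum_nonneg) simp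
  have k: "inner u ?w = k"
    unfolding d(3) inner_sum_left k_def
    by (intro sum.cong) (simp_all add: inner_facet_dual(2)[OF d(1)] inner_commute[of _ ?w])
  have "inner u u = (\<Sum>e\<in>S - {d}. c e * inner u e)"
    by (subst (2) d(3)) (simp add: inner_sum_right)
  also have "\<dots> \<le> (\<Sum>e\<in>S - {d}. c e * (m * norm e))"
  proof (intro sum_mono mult_left_mono d(2))
    fix e assume e: "e \<in> S - {d}"
    have "inner u e / norm e \<le> m"
      using m[of e] e by (simp add: sgn_div_norm divide_inverse mult.commute)
    moreover have "0 < norm e"
      using e nonzero by auto
    ultimately show "inner u e \<le> m * norm e"
      by (simp only: pos_divide_le_eq)
  qed
  also have "\<dots> = m * k"
    by (simp add: k_def sum_distrib_left mult_ac)
  finally have le: "(norm u)\<^sup>2 \<le> m * k"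
    by (simp add: power2_norm_eq_inner)
  have "(norm (u - m *\<^sub>R ?w))\<^sup>2 = (norm u)\<^sup>2 - 2 * (m * k) + m\<^sup>2 * (norm ?w)\<^sup>2"
    unfolding power2_norm_eq_inner k[symmetric]
    by (simp add: inner_diff_left inner_diff_right inner_commute[of ?w u] power2_eq_square
        algebra_simps)
  then have "(norm (u - m *\<^sub>R ?w))\<^sup>2 \<le> m\<^sup>2 * (norm ?w)\<^sup>2 - (norm u)\<^sup>2"
    using le by simp
  moreover have "u = 0" if "m \<le> 0"
  proof -
    have "m * k \<le> 0"
      using that \<open>0 \<le> k\<close> by (rule mult_nonpos_nonneg)
    then have "(norm u)\<^sup>2 \<le> 0"
      using le by (rule order_trans[rotated])
    then show ?thesis
      by simp
  qed
  ultimately show ?thesis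
    by (intro that[OF d(1)])
qed

end

lemma minimal_positive_basis_simplicial:
  fixes D :: "(real ^ 'n) list"
  assumes "subspace L" "minimal_positive_basis L D"
  shows "simplicial_family L (set D)" and "distinct D"
proof -
  have D: "set D \<subseteq> L" "0 \<notin> set D" "pspan D = L" "length D = dim L + 1"
    using assms(2)
    by (auto simp: minimal_positive_basis_def positive_basis_def positive_spanning_set_def)
  show simp: "simplicial_family L (set D)"
  proof
    show "\<exists>c. (\<forall>d\<in>set D. 0 \<le> c d) \<and> u = (\<Sum>d\<in>set D. c d *\<^sub>R d)" if "u \<in> L" for u
      using pspan_elim[of u D] that D(3) by metis
  qed (use assms(1) D card_length[of D] in auto)
  show "distinct D"
    using simplicial_family.card_eq[OF simp] D(4) by (intro card_distinct) simp
qed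

section \<open>Orthogonal decompositions\<close>

locale ospb_with_decomposition =
  fixes D :: "(real ^ 'n) list" and s :: nat
    and L :: "nat \<Rightarrow> (real ^ 'n) set" and DL :: "nat \<Rightarrow> (real ^ 'n) list"
  assumes ospb: "ospb D s"
    and decomposition: "ospb_decomposition D s L DL"
begin

lemma subspace_block: "i < s \<Longrightarrow> subspace (L i)"
  using decomposition by (simp add: ospb_decomposition_def)

lemma orthogonal_blocks:
  "i < s \<Longrightarrow> j < s \<Longrightarrow> i \<noteq> j \<Longrightarrow> x \<in> L i \<Longrightarrow> y \<in> L j \<Longrightarrow> real_inner_class.orthogonal x y"
  using decomposition by (simp add: ospb_decomposition_def)

lemma block_components:
  obtains x where "\<And>i. i < s \<Longrightarrow> x i \<in> L i" "u = (\<Sum>i<s. x i)"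
proof -
  have "u \<in> {(\<Sum>i<s. x i) | x. \<forall>i<s. x i \<in> L i}"
    using decomposition by (simp add: ospb_decomposition_def)
  then show ?thesis
    using that by blast
qed

lemma minimal_positive_basis_block: "i < s \<Longrightarrow> minimal_positive_basis (L i) (DL i)"
  using decomposition by (simp add: ospb_decomposition_def)

lemma simplicial_block: "i < s \<Longrightarrow> simplicial_family (L i) (set (DL i))"
  by (intro minimal_positive_basis_simplicial(1) subspace_block minimal_positive_basis_block)

lemma distinct_block: "i < s \<Longrightarrow> distinct (DL i)"
  by (rule minimal_positive_basis_simplicial(2)[OF subspace_block minimal_positive_basis_block])

lemma block_subset: "i < s \<Longrightarrow> set (DL i) \<subseteq> L i"
  using simplicial_family.subset[OF simplicial_block] .

lemma block_nonempty: "i < s \<Longrightarrow> set (DL i) \<noteq> {}"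
  using simplicial_family.nonempty[OF simplicial_block] .

lemma mset_D: "mset D = mset (concat (map DL [0..<s]))"
  using decomposition by (simp add: ospb_decomposition_def)

lemma set_D: "set D = (\<Union>i<s. set (DL i))"
  using mset_eq_setD[OF mset_D] by (simp add: lessThan_atLeast0)

text \<open>
  A nonzero vector lies in at most one of pairwise orthogonal subspaces.
\<close>

lemma in_block:
  assumes "d \<in> set D" "i < s" "d \<in> L i"
  shows "d \<in> set (DL i)"
proof -
  obtain j where j: "j < s" "d \<in> set (DL j)"
    using assms(1) set_D by auto
  have "d \<noteq> 0"
    using simplicial_family.nonzero[OF simplicial_block[OF j(1)]] j(2) by auto
  have "j = i"
  proof (rule ccontr)
    assume "j \<noteq> i"
    then have "real_inner_class.orthogonal d d"
      using j assms block_subset by (intro orthogonal_blocks[of j i]) auto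
    then show False
      using \<open>d \<noteq> 0\<close> by (simp add: real_inner_class.orthogonal_def)
  qed
  then show ?thesis
    using j(2) by simp
qed

text \<open>
  \<open>D\<close> exceeds the dimension of the space by \<open>s\<close> elements, and each of the \<open>s\<close> minimal positive bases
  exceeds the dimension of its subspace by one.
\<close>

lemma sum_dim_blocks: "(\<Sum>i<s. dim (L i)) = CARD('n)"
proof -
  have "CARD('n) + s = length D"
    using ospb by (simp add: ospb_def)
  also have "\<dots> = length (concat (map DL [0..<s]))"
    using mset_eq_length[OF mset_D] .
  also have "\<dots> = (\<Sum>i<s. length (DL i))"
    by (simp add: length_concat comp_def interv_sum_list_conv_sum_set_nat lessThan_atLeast0)
  also have "\<dots> = (\<Sum>i<s. dim (L i) + 1)"
    using minimal_positive_basis_block by (intro sum.cong) (simp_all add: minimal_positive_basis_def)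
  also have "\<dots> = (\<Sum>i<s. dim (L i)) + s"
    unfolding sum.distrib by simp
  finally show ?thesis
    by simp
qed

text \<open>
  Otherwise there would be no subspaces at all, and the whole space would be trivial.
\<close>

lemma D_nonempty: "set D \<noteq> {}"
proof
  assume "set D = {}"
  then have "s = 0"
    using set_D block_nonempty by (cases s) auto
  then have "(axis undefined 1 :: real ^ 'n) = 0"
    using block_components[of "axis undefined 1"] by (metis sum.empty lessThan_0)
  then show False
    by (simp add: axis_eq_0_iff)
qed

text \<open>
  The bases may contain vectors outside \<open>D\<close>: normalization produces such bases.
\<close>

lemma sum_formulas:
  assumes B: "linear_basis UNIV B"
    and BL: "\<And>i. i < s \<Longrightarrow> linear_basis (L i) (BL i)"
    and mset_B: "mset B = mset (concat (map BL [0..<s]))"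
  shows "dual_ones (set B) = (\<Sum>i<s. dual_ones (set (BL i)))"
    and "gamma B = 1 / sqrt (\<Sum>i<s. gamma (BL i) powi (-2))"
    and "gamma B = 1 / sqrt (\<Sum>i<s. ones_inv_gram_ones (BL i))"
    and "u_vec B = (1 / sqrt (\<Sum>i<s. gamma (BL i) powi (-2))) *\<^sub>R
                    inv_transpose_ones (concat (map BL [0..<s]))"
proof -
  have ind: "independent (set (BL i))" "distinct (BL i)" "span (set (BL i)) = L i" if "i < s" for i
    using BL[OF that] by (auto simp: linear_basis_def)
  have B': "distinct B" "independent (set B)"
    using B by (auto simp: linear_basis_def)
  have set_B: "set B = (\<Union>i<s. set (BL i))"
    using mset_eq_setD[OF mset_B] by (simp add: lessThan_atLeast0)
  have orth: "real_inner_class.orthogonal x y"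
    if "i < s" "j < s" "i \<noteq> j" "x \<in> span (set (BL i))" "y \<in> span (set (BL j))" for i j x y
    using that orthogonal_blocks ind(3) by simp
  note dual = dual_ones_UN_orthogonal[of s "\<lambda>i. set (BL i)", OF ind(1) orth, folded set_B]
  show "dual_ones (set B) = (\<Sum>i<s. dual_ones (set (BL i)))"
    by (rule dual(1))
  have norm: "norm (dual_ones (set B)) = sqrt (\<Sum>i<s. (norm (dual_ones (set (BL i))))\<^sup>2)"
    by (simp add: dual(2)[symmetric])
  have "(\<Sum>i<s. gamma (BL i) powi (-2)) = (\<Sum>i<s. (norm (dual_ones (set (BL i))))\<^sup>2)"
    by (intro sum.cong refl gamma_eq(2) ind) auto
  then show gamma: "gamma B = 1 / sqrt (\<Sum>i<s. gamma (BL i) powi (-2))"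
    by (simp only: gamma_eq(1)[OF B'] norm)
  have "(\<Sum>i<s. ones_inv_gram_ones (BL i)) = (\<Sum>i<s. (norm (dual_ones (set (BL i))))\<^sup>2)"
    by (intro sum.cong refl ones_inv_gram_ones_eq ind) auto
  then show "gamma B = 1 / sqrt (\<Sum>i<s. ones_inv_gram_ones (BL i))"
    by (simp only: gamma_eq(1)[OF B'] norm)
  have set_concat: "set (concat (map BL [0..<s])) = set B"
    by (rule mset_eq_setD[OF mset_B, symmetric])
  have "distinct (concat (map BL [0..<s]))"
    by (rule iffD1[OF mset_eq_imp_distinct_iff[OF mset_B] B'(1)])
  then have "linear_basis UNIV (concat (map BL [0..<s]))"
    using B unfolding linear_basis_def set_concat by blast
  then have "inv_transpose_ones (concat (map BL [0..<s])) = inv_transpose_ones B"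
    using B by (simp only: inv_transpose_ones_eq set_concat)
  then show "u_vec B = (1 / sqrt (\<Sum>i<s. gamma (BL i) powi (-2))) *\<^sub>R
                    inv_transpose_ones (concat (map BL [0..<s]))"
    by (simp only: u_vec_def gamma)
qed

section \<open>The cosine measure and the cosine vectors\<close>

text \<open>
  One element to be removed from each minimal positive basis.
\<close>

definition facet_choice :: "(nat \<Rightarrow> real ^ 'n) \<Rightarrow> bool" where
  "facet_choice d \<longleftrightarrow> (\<forall>i<s. d i \<in> set (DL i))"

definition choice_dual :: "(nat \<Rightarrow> real ^ 'n) \<Rightarrow> real ^ 'n" where
  "choice_dual d = (\<Sum>i<s. simplicial_family.facet_dual (set (DL i)) (d i))"

text \<open>
  The largest squared norm of a \<^term>\<open>choice_dual\<close>; the cosine measure turns out to be the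
  reciprocal of its square root.
\<close>

definition sum_Max :: real where
  "sum_Max = (\<Sum>i<s. MAX d\<in>set (DL i). (norm (simplicial_family.facet_dual (set (DL i)) d))\<^sup>2)"

lemma facet_dual_in_block:
  assumes "facet_choice d" "i < s"
  shows "simplicial_family.facet_dual (set (DL i)) (d i) \<in> L i"
  using simplicial_family.facet_dual_in[OF simplicial_block[OF assms(2)]] assms
  by (simp add: facet_choice_def)

lemma norm_choice_dual:
  assumes "facet_choice d"
  shows "(norm (choice_dual d))\<^sup>2 =
    (\<Sum>i<s. (norm (simplicial_family.facet_dual (set (DL i)) (d i)))\<^sup>2)"
  unfolding choice_dual_def
proof (rule norm_sum_Pythagorean)
  show "pairwise (\<lambda>i j. real_inner_class.orthogonal
      (simplicial_family.facet_dual (set (DL i)) (d i))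
      (simplicial_family.facet_dual (set (DL j)) (d j))) {..<s}"
    using facet_dual_in_block[OF assms] orthogonal_blocks by (auto simp: pairwise_def)
qed simp

lemma inner_block:
  assumes x: "\<And>i. i < s \<Longrightarrow> x i \<in> L i" and j: "j < s" "e \<in> set (DL j)"
  shows "inner (\<Sum>i<s. x i) (sgn e) = inner (x j) (sgn e)"
proof -
  have "sgn e \<in> L j"
    unfolding sgn_div_norm using block_subset j by (intro subspace_scale subspace_block) auto
  then have "inner (x i) (sgn e) = 0" if "i < s" "i \<noteq> j" for i
    using orthogonal_blocks[of i j "x i" "sgn e"] x that j(1)
    by (simp add: real_inner_class.orthogonal_def)
  then have "(\<Sum>i<s. inner (x i) (sgn e)) = (\<Sum>i<s. if i = j then inner (x j) (sgn e) else 0)"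
    by (intro sum.cong) auto
  then show ?thesis
    using j(1) by (simp add: inner_sum_left)
qed

lemma inner_choice_dual_le:
  assumes "facet_choice d" "e \<in> set D"
  shows "inner (choice_dual d) (sgn e) \<le> 1"
proof -
  obtain j where j: "j < s" "e \<in> set (DL j)"
    using assms(2) set_D by auto
  have "inner (choice_dual d) (sgn e) =
      inner (simplicial_family.facet_dual (set (DL j)) (d j)) (sgn e)"
    unfolding choice_dual_def by (rule inner_block[OF facet_dual_in_block[OF assms(1)] j])
  also have "\<dots> \<le> 1"
    using simplicial_family.inner_facet_dual_le[OF simplicial_block[OF j(1)] _ j(2)] assms(1) j(1)
    by (simp add: facet_choice_def)
  finally show ?thesis .
qed

lemma max_cosine_ge: "d \<in> set D \<Longrightarrow> inner u (sgn d) \<le> max_cosine D u"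
  unfolding max_cosine_def
  by (intro Max_ge) (auto simp: sgn_div_norm divide_inverse mult.commute)

lemma max_cosine_le:
  assumes "\<And>d. d \<in> set D \<Longrightarrow> inner u (sgn d) \<le> m"
  shows "max_cosine D u \<le> m"
  unfolding max_cosine_def
  using assms D_nonempty by (auto simp: sgn_div_norm divide_inverse mult.commute)

text \<open>
  The estimates for the components of \<open>u\<close> add up by the theorem of Pythagoras.
\<close>

lemma dist_choice_dual_le:
  assumes "norm u = 1"
  obtains d where "facet_choice d" "0 < max_cosine D u"
    "(norm (u - max_cosine D u *\<^sub>R choice_dual d))\<^sup>2 \<le> (max_cosine D u)\<^sup>2 * sum_Max - 1"
proof -
  let ?w = "\<lambda>i. simplicial_family.facet_dual (set (DL i))"
  define m where "m = max_cosine D u"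
  obtain x where x: "\<And>i. i < s \<Longrightarrow> x i \<in> L i" "u = (\<Sum>i<s. x i)"
    by (rule block_components) blast
  have le: "inner (x i) (sgn e) \<le> m" if "i < s" "e \<in> set (DL i)" for i e
  proof -
    have "inner u (sgn e) = inner (x i) (sgn e)"
      unfolding x(2) by (rule inner_block[OF x(1) that])
    moreover have "e \<in> set D"
      using that set_D by auto
    ultimately show ?thesis
      using max_cosine_ge[of e u] by (simp only: m_def)
  qed
  have "\<exists>d. d \<in> set (DL i) \<and>
      (norm (x i - m *\<^sub>R ?w i d))\<^sup>2 \<le> m\<^sup>2 * (norm (?w i d))\<^sup>2 - (norm (x i))\<^sup>2 \<and>
      (m \<le> 0 \<longrightarrow> x i = 0)" if "i < s" for i
    using simplicial_family.dist_facet_dual_le[OF simplicial_block[OF that] x(1)[OF that] le[OF that]]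
    by metis
  then obtain d where d: "\<And>i. i < s \<Longrightarrow> d i \<in> set (DL i)"
    "\<And>i. i < s \<Longrightarrow> (norm (x i - m *\<^sub>R ?w i (d i)))\<^sup>2 \<le> m\<^sup>2 * (norm (?w i (d i)))\<^sup>2 - (norm (x i))\<^sup>2"
    "\<And>i. i < s \<Longrightarrow> m \<le> 0 \<Longrightarrow> x i = 0"
    by metis
  have choice: "facet_choice d"
    using d(1) by (simp add: facet_choice_def)
  have "0 < m"
  proof (rule ccontr)
    assume "\<not> 0 < m"
    then have "u = 0"
      unfolding x(2) using d(3) by (intro sum.neutral) auto
    then show False
      using assms by simp
  qed
  have norm_u: "(\<Sum>i<s. (norm (x i))\<^sup>2) = 1"
  proof -
    have "(norm u)\<^sup>2 = (\<Sum>i<s. (norm (x i))\<^sup>2)"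
      unfolding x(2)
      by (rule norm_sum_Pythagorean) (auto simp: pairwise_def intro: orthogonal_blocks x(1))
    then show ?thesis
      using assms by simp
  qed
  have "u - m *\<^sub>R choice_dual d = (\<Sum>i<s. x i - m *\<^sub>R ?w i (d i))"
    by (simp add: x(2) choice_dual_def scaleR_sum_right sum_subtractf)
  also have "(norm \<dots>)\<^sup>2 = (\<Sum>i<s. (norm (x i - m *\<^sub>R ?w i (d i)))\<^sup>2)"
  proof (rule norm_sum_Pythagorean)
    have "x i - m *\<^sub>R ?w i (d i) \<in> L i" if "i < s" for i
      using x(1) facet_dual_in_block[OF choice] that
      by (intro subspace_diff subspace_scale subspace_block)
    then show "pairwise (\<lambda>i j. real_inner_class.orthogonal (x i - m *\<^sub>R ?w i (d i))
        (x j - m *\<^sub>R ?w j (d j))) {..<s}"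
      using orthogonal_blocks by (auto simp: pairwise_def)
  qed simp
  also have "\<dots> \<le> (\<Sum>i<s. m\<^sup>2 * (MAX d\<in>set (DL i). (norm (?w i d))\<^sup>2) - (norm (x i))\<^sup>2)"
  proof (rule sum_mono)
    fix i assume "i \<in> {..<s}"
    then have i: "i < s"
      by simp
    have "(norm (?w i (d i)))\<^sup>2 \<le> (MAX d\<in>set (DL i). (norm (?w i d))\<^sup>2)"
      using d(1)[OF i] by (intro Max_ge) auto
    then have "m\<^sup>2 * (norm (?w i (d i)))\<^sup>2 \<le> m\<^sup>2 * (MAX d\<in>set (DL i). (norm (?w i d))\<^sup>2)"
      by (rule mult_left_mono) simp
    then show "(norm (x i - m *\<^sub>R ?w i (d i)))\<^sup>2 \<le>
        m\<^sup>2 * (MAX d\<in>set (DL i). (norm (?w i d))\<^sup>2) - (norm (x i))\<^sup>2"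
      using d(2)[OF i] by linarith
  qed
  also have "\<dots> = m\<^sup>2 * sum_Max - 1"
    by (simp add: sum_subtractf norm_u sum_Max_def sum_distrib_left)
  finally have "(norm (u - m *\<^sub>R choice_dual d))\<^sup>2 \<le> m\<^sup>2 * sum_Max - 1" .
  then show ?thesis
    using that[OF choice] \<open>0 < m\<close> by (simp only: m_def)
qed

text \<open>
  The squared distance in the previous estimate is nonnegative.
\<close>

lemma max_cosine_lower_bound:
  assumes "norm u = 1"
  shows "0 < sum_Max" and "1 / sqrt sum_Max \<le> max_cosine D u"
proof -
  let ?m = "max_cosine D u"
  obtain d where d: "0 < ?m" "(norm (u - ?m *\<^sub>R choice_dual d))\<^sup>2 \<le> ?m\<^sup>2 * sum_Max - 1"
    by (rule dist_choice_dual_le[OF assms]) blast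
  have ge: "1 \<le> ?m\<^sup>2 * sum_Max"
    using d(2) zero_le_power2[of "norm (u - ?m *\<^sub>R choice_dual d)"] by linarith
  then have "0 < ?m\<^sup>2 * sum_Max"
    by linarith
  then show pos: "0 < sum_Max"
    using d(1) by (simp add: zero_less_mult_iff)
  have "1 \<le> sqrt (?m\<^sup>2 * sum_Max)"
    using ge by simp
  also have "\<dots> = ?m * sqrt sum_Max"
    using d(1) by (simp add: real_sqrt_mult)
  finally show "1 / sqrt sum_Max \<le> ?m"
    using pos by (simp add: pos_divide_le_eq)
qed

lemma sum_Max_pos: "0 < sum_Max"
  by (rule max_cosine_lower_bound(1)[of "axis undefined 1"]) simp

lemma max_cosine_choice_dual:
  assumes "facet_choice d" "norm (choice_dual d) = sqrt sum_Max"
  shows "norm ((1 / sqrt sum_Max) *\<^sub>R choice_dual d) = 1"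
    and "max_cosine D ((1 / sqrt sum_Max) *\<^sub>R choice_dual d) = 1 / sqrt sum_Max"
proof -
  let ?u = "(1 / sqrt sum_Max) *\<^sub>R choice_dual d"
  show norm: "norm ?u = 1"
    unfolding norm_scaleR assms(2) using sum_Max_pos by simp
  have "max_cosine D ?u \<le> 1 / sqrt sum_Max"
  proof (rule max_cosine_le)
    fix e assume "e \<in> set D"
    then have "1 / sqrt sum_Max * inner (choice_dual d) (sgn e) \<le> 1 / sqrt sum_Max * 1"
      using inner_choice_dual_le[OF assms(1)] sum_Max_pos by (intro mult_left_mono) auto
    then show "inner ?u (sgn e) \<le> 1 / sqrt sum_Max"
      by simp
  qed
  then show "max_cosine D ?u = 1 / sqrt sum_Max"
    using max_cosine_lower_bound(2)[OF norm] by (rule antisym)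
qed

lemma maximal_choice:
  obtains d where "facet_choice d" "norm (choice_dual d) = sqrt sum_Max"
proof -
  let ?w = "\<lambda>i. simplicial_family.facet_dual (set (DL i))"
  have "\<exists>d. d \<in> set (DL i) \<and> (norm (?w i d))\<^sup>2 = (MAX d\<in>set (DL i). (norm (?w i d))\<^sup>2)"
    if "i < s" for i
  proof -
    have "(MAX d\<in>set (DL i). (norm (?w i d))\<^sup>2) \<in> (\<lambda>d. (norm (?w i d))\<^sup>2) ` set (DL i)"
      using block_nonempty[OF that] by (intro Max_in) auto
    then show ?thesis
      by auto
  qed
  then obtain d where d: "\<And>i. i < s \<Longrightarrow> d i \<in> set (DL i)"
    "\<And>i. i < s \<Longrightarrow> (norm (?w i (d i)))\<^sup>2 = (MAX d\<in>set (DL i). (norm (?w i d))\<^sup>2)"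
    by metis
  have choice: "facet_choice d"
    using d(1) by (simp add: facet_choice_def)
  have "(norm (choice_dual d))\<^sup>2 = sum_Max"
    unfolding norm_choice_dual[OF choice] sum_Max_def by (intro sum.cong refl d(2)) simp
  then have "norm (choice_dual d) = sqrt sum_Max"
    by (intro real_sqrt_unique[symmetric]) auto
  then show ?thesis
    by (rule that[OF choice])
qed

lemma cosine_measure_eq: "cosine_measure D = 1 / sqrt sum_Max"
proof -
  obtain d where d: "facet_choice d" "norm (choice_dual d) = sqrt sum_Max"
    by (rule maximal_choice) blast
  note u = max_cosine_choice_dual[OF d]
  show ?thesis
    unfolding cosine_measure_def
  proof (rule cInf_eq_minimum)
    show "1 / sqrt sum_Max \<in> max_cosine D ` {u. norm u = 1}"
      using u by (intro image_eqI[where x = "(1 / sqrt sum_Max) *\<^sub>R choice_dual d"])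
        (simp_all only: mem_Collect_eq)
  qed (auto intro: max_cosine_lower_bound(2))
qed

text \<open>
  When the largest cosine is as small as possible, the right side of the estimate vanishes, which forces
  \<open>u\<close> to be the multiple of \<^term>\<open>choice_dual d\<close>; having norm 1 then makes the choice maximal.
\<close>

lemma cosine_vector_set_eq:
  "cosine_vector_set D =
    {(1 / sqrt sum_Max) *\<^sub>R choice_dual d | d. facet_choice d \<and> norm (choice_dual d) = sqrt sum_Max}"
proof (intro Set.set_eqI iffI)
  fix u assume "u \<in> cosine_vector_set D"
  then have u: "norm u = 1" "max_cosine D u = 1 / sqrt sum_Max"
    by (auto simp: cosine_vector_set_def cosine_measure_eq)
  obtain d where d: "facet_choice d"
    "(norm (u - max_cosine D u *\<^sub>R choice_dual d))\<^sup>2 \<le> (max_cosine D u)\<^sup>2 * sum_Max - 1"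
    by (rule dist_choice_dual_le[OF u(1)]) blast
  have "(1 / sqrt sum_Max)\<^sup>2 * sum_Max = 1"
    using sum_Max_pos by (simp add: power_divide)
  then have "(norm (u - (1 / sqrt sum_Max) *\<^sub>R choice_dual d))\<^sup>2 \<le> 0"
    using d(2) by (simp only: u(2))
  then have eq: "u = (1 / sqrt sum_Max) *\<^sub>R choice_dual d"
    by (simp only: power2_less_eq_zero_iff norm_eq_zero right_minus_eq)
  have "norm (choice_dual d) = norm u * sqrt sum_Max"
    unfolding eq norm_scaleR using sum_Max_pos by simp
  then have "norm (choice_dual d) = sqrt sum_Max"
    using u(1) by (simp only: mult_1)
  then show "u \<in> {(1 / sqrt sum_Max) *\<^sub>R choice_dual d | d.
      facet_choice d \<and> norm (choice_dual d) = sqrt sum_Max}"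
    using eq d(1) by blast
next
  fix u assume "u \<in> {(1 / sqrt sum_Max) *\<^sub>R choice_dual d | d.
      facet_choice d \<and> norm (choice_dual d) = sqrt sum_Max}"
  then obtain d where d: "facet_choice d" "norm (choice_dual d) = sqrt sum_Max"
    and u: "u = (1 / sqrt sum_Max) *\<^sub>R choice_dual d"
    by blast
  show "u \<in> cosine_vector_set D"
    unfolding cosine_vector_set_def u mem_Collect_eq cosine_measure_eq
    using max_cosine_choice_dual[OF d] by (rule conjI)
qed

section \<open>Structured bases as choices of removed elements\<close>

lemma structured_basis_subset: "structured_basis D s L BL B \<Longrightarrow> set B \<subseteq> set D"
  using set_mset_mono[of "mset B" "mset D"] unfolding structured_basis_def set_mset_mset by blast

lemma structured_basis_map_sgn:
  assumes "structured_basis D s L BL B"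
  shows "linear_basis UNIV (map sgn B)"
    and "i < s \<Longrightarrow> linear_basis (L i) (map sgn (BL i))"
    and "mset (map sgn B) = mset (concat (map (\<lambda>i. map sgn (BL i)) [0..<s]))"
proof -
  show "linear_basis UNIV (map sgn B)" and "i < s \<Longrightarrow> linear_basis (L i) (map sgn (BL i))"
    using assms linear_basis_map_sgn by (auto simp: structured_basis_def)
  have "mset (map sgn B) = image_mset sgn (mset (concat (map BL [0..<s])))"
    using assms by (simp add: structured_basis_def)
  also have "\<dots> = mset (map sgn (concat (map BL [0..<s])))"
    by (simp only: mset_map)
  also have "map sgn (concat (map BL [0..<s])) = concat (map (\<lambda>i. map sgn (BL i)) [0..<s])"
    by (simp add: map_concat comp_def)
  finally show "mset (map sgn B) = mset (concat (map (\<lambda>i. map sgn (BL i)) [0..<s]))" .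
qed

lemma dual_ones_structured_basis:
  assumes "structured_basis D s L BL B"
    and "\<And>i. i < s \<Longrightarrow> set (BL i) = set (DL i) - {d i}"
  shows "dual_ones (set (map sgn B)) = choice_dual d"
proof -
  have "dual_ones (set (map sgn B)) = (\<Sum>i<s. dual_ones (set (map sgn (BL i))))"
    by (rule sum_formulas(1)[OF structured_basis_map_sgn[OF assms(1)]])
  also have "\<dots> = choice_dual d"
    unfolding choice_dual_def
    by (intro sum.cong refl)
      (simp only: lessThan_iff set_map assms(2) simplicial_family.facet_dual_def[OF simplicial_block])
  finally show ?thesis .
qed

text \<open>
  Each part of the basis lies in its minimal positive basis and has one element less.
\<close>

lemma structured_basis_imp_choice:
  assumes "structured_basis D s L BL B"
  obtains d where "facet_choice d" "dual_ones (set (map sgn B)) = choice_dual d"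
proof -
  have "\<exists>d. d \<in> set (DL i) \<and> set (BL i) = set (DL i) - {d}" if i: "i < s" for i
  proof -
    have basis: "linear_basis (L i) (BL i)" and sub: "set B \<subseteq> set D"
      using assms i structured_basis_subset by (auto simp: structured_basis_def)
    have "set B = (\<Union>i<s. set (BL i))"
      using assms mset_eq_setD[of B "concat (map BL [0..<s])"]
      by (simp add: structured_basis_def lessThan_atLeast0)
    moreover have "set (BL i) \<subseteq> L i"
      using basis span_superset by (auto simp: linear_basis_def)
    ultimately have subset: "set (BL i) \<subseteq> set (DL i)"
      using sub in_block[OF _ i] i by blast
    have "card (set (BL i)) = dim (L i)"
      using linear_basis_length[OF basis] basis by (simp add: linear_basis_def distinct_card)
    then have "card (set (DL i) - set (BL i)) = 1"
      using simplicial_family.card_eq[OF simplicial_block[OF i]] card_Diff_subset[OF _ subset]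
      by simp
    then obtain d where "set (DL i) - set (BL i) = {d}"
      by (rule card_1_singletonE)
    then show ?thesis
      using subset by blast
  qed
  then obtain d where d: "\<And>i. i < s \<Longrightarrow> d i \<in> set (DL i)"
    "\<And>i. i < s \<Longrightarrow> set (BL i) = set (DL i) - {d i}"
    by metis
  show ?thesis
    using that[of d] d(1) dual_ones_structured_basis[OF assms d(2)] by (simp add: facet_choice_def)
qed

lemma set_remove1_block: "i < s \<Longrightarrow> set (remove1 d (DL i)) = set (DL i) - {d}"
  using distinct_block by (simp add: set_remove1_eq)

lemma linear_basis_remove1:
  assumes "i < s" "d \<in> set (DL i)"
  shows "linear_basis (L i) (remove1 d (DL i))"
  using simplicial_family.span_facet[OF simplicial_block] simplicial_family.independent_facet[OF simplicial_block]
    assms distinct_block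
  by (simp add: linear_basis_def set_remove1_block)

text \<open>
  The remaining elements span every subspace, hence the whole space, and there are only as many of them
  as the dimension.
\<close>

lemma choice_imp_structured_basis:
  assumes "facet_choice d"
  obtains B BL where "structured_basis D s L BL B" "dual_ones (set (map sgn B)) = choice_dual d"
proof -
  define BL where "BL i = remove1 (d i) (DL i)" for i
  define B where "B = concat (map BL [0..<s])"
  have BL: "linear_basis (L i) (BL i)" if "i < s" for i
    unfolding BL_def using linear_basis_remove1[OF that] assms that by (simp add: facet_choice_def)
  have set_B: "set B = (\<Union>i<s. set (BL i))"
    by (simp add: B_def lessThan_atLeast0)
  have "u \<in> span (set B)" for u
  proof -
    obtain x where x: "\<And>i. i < s \<Longrightarrow> x i \<in> L i" "u = (\<Sum>i<s. x i)"
      by (rule block_components) blast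
    have "x i \<in> span (set B)" if "i < s" for i
      using x(1)[OF that] BL[OF that] span_mono[of "set (BL i)" "set B"] set_B that
      by (auto simp: linear_basis_def)
    then show ?thesis
      unfolding x(2) by (intro span_sum) simp
  qed
  moreover have "length B = CARD('n)"
  proof -
    have "length B = (\<Sum>i<s. length (BL i))"
      by (simp add: B_def length_concat comp_def interv_sum_list_conv_sum_set_nat lessThan_atLeast0)
    also have "\<dots> = (\<Sum>i<s. dim (L i))"
      by (intro sum.cong linear_basis_length BL) auto
    finally show ?thesis
      by (simp add: sum_dim_blocks)
  qed
  ultimately have basis: "linear_basis UNIV B"
    by (intro linear_basis_of_spanning) auto
  have "set B \<subseteq> set D"
    using set_B set_D set_remove1_subset by (force simp: BL_def)
  moreover have "distinct B"
    using basis by (simp add: linear_basis_def)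
  ultimately have "mset B \<subseteq># mset D"
    by (auto simp: subseteq_mset_def distinct_count_atmost_1 Suc_le_eq count_greater_zero_iff)
  then have "structured_basis D s L BL B"
    using basis BL by (simp add: structured_basis_def B_def)
  moreover from this have "dual_ones (set (map sgn B)) = choice_dual d"
    by (rule dual_ones_structured_basis) (simp add: BL_def set_remove1_block)
  ultimately show ?thesis
    by (rule that)
qed

section \<open>The formulas\<close>

lemma cosine_measure_formula:
  "cosine_measure D =
     1 / sqrt (\<Sum>i<s. MAX d\<in>set (DL i). gamma (map sgn (remove1 d (DL i))) powi (-2))"
proof -
  have "gamma (map sgn (remove1 d (DL i))) powi (-2) =
      (norm (simplicial_family.facet_dual (set (DL i)) d))\<^sup>2" if "i < s" "d \<in> set (DL i)" for i d
  proof -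
    have "linear_basis (L i) (map sgn (remove1 d (DL i)))"
      by (intro linear_basis_map_sgn linear_basis_remove1 that)
    then have "gamma (map sgn (remove1 d (DL i))) powi (-2) =
        (norm (dual_ones (set (map sgn (remove1 d (DL i))))))\<^sup>2"
      unfolding linear_basis_def by (intro gamma_eq(2)) blast+
    also have "set (map sgn (remove1 d (DL i))) = sgn ` (set (DL i) - {d})"
      by (simp only: set_map set_remove1_block[OF that(1)])
    finally show ?thesis
      by (simp only: simplicial_family.facet_dual_def[OF simplicial_block[OF that(1)]])
  qed
  then have "(\<Sum>i<s. MAX d\<in>set (DL i). gamma (map sgn (remove1 d (DL i))) powi (-2)) = sum_Max"
    unfolding sum_Max_def by (intro sum.cong refl arg_cong[of _ _ Max] image_cong) auto
  then show ?thesis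
    by (simp only: cosine_measure_eq)
qed

lemma u_vec_map_sgn:
  assumes "structured_basis D s L BL B"
  shows "gamma (map sgn B) = 1 / norm (dual_ones (set (map sgn B)))"
    and "u_vec (map sgn B) = gamma (map sgn B) *\<^sub>R dual_ones (set (map sgn B))"
    and "u_vec (map sgn B) = (1 / sqrt (\<Sum>i<s. gamma (map sgn (BL i)) powi (-2))) *\<^sub>R
      inv_transpose_ones (map sgn (concat (map BL [0..<s])))"
proof -
  note sgn = structured_basis_map_sgn[OF assms]
  show "gamma (map sgn B) = 1 / norm (dual_ones (set (map sgn B)))"
    using sgn(1) unfolding linear_basis_def by (intro gamma_eq(1)) blast+
  show "u_vec (map sgn B) = gamma (map sgn B) *\<^sub>R dual_ones (set (map sgn B))"
    by (simp only: u_vec_def inv_transpose_ones_eq[OF sgn(1)])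
  have "map sgn (concat (map BL [0..<s])) = concat (map (\<lambda>i. map sgn (BL i)) [0..<s])"
    by (simp add: map_concat comp_def)
  then show "u_vec (map sgn B) = (1 / sqrt (\<Sum>i<s. gamma (map sgn (BL i)) powi (-2))) *\<^sub>R
      inv_transpose_ones (map sgn (concat (map BL [0..<s])))"
    using sum_formulas(4)[OF sgn] by (simp only:)
qed

lemma cosine_vector_set_formula:
  "cosine_vector_set D =
     {u_vec (map sgn B) | B BL.
        structured_basis D s L BL B \<and> gamma (map sgn B) = cosine_measure D \<and>
        u_vec (map sgn B) = (1 / sqrt (\<Sum>i<s. gamma (map sgn (BL i)) powi (-2))) *\<^sub>R
                              inv_transpose_ones (map sgn (concat (map BL [0..<s])))}"
  (is "_ = ?R")
proof (intro Set.set_eqI iffI)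
  fix u assume "u \<in> cosine_vector_set D"
  then obtain d where d: "facet_choice d" "norm (choice_dual d) = sqrt sum_Max"
    and u: "u = (1 / sqrt sum_Max) *\<^sub>R choice_dual d"
    unfolding cosine_vector_set_eq by blast
  obtain B BL where B: "structured_basis D s L BL B" "dual_ones (set (map sgn B)) = choice_dual d"
    by (rule choice_imp_structured_basis[OF d(1)]) blast
  have gamma: "gamma (map sgn B) = 1 / sqrt sum_Max"
    unfolding u_vec_map_sgn(1)[OF B(1)] B(2) d(2) ..
  then have "u = u_vec (map sgn B)"
    unfolding u_vec_map_sgn(2)[OF B(1)] B(2) u by (simp only:)
  moreover have "gamma (map sgn B) = cosine_measure D"
    unfolding gamma cosine_measure_eq ..
  ultimately show "u \<in> ?R"
    using B(1) u_vec_map_sgn(3)[OF B(1)] by blast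
next
  fix u assume "u \<in> ?R"
  then obtain B BL where B: "structured_basis D s L BL B" "gamma (map sgn B) = cosine_measure D"
    and u: "u = u_vec (map sgn B)"
    by blast
  obtain d where d: "facet_choice d" "dual_ones (set (map sgn B)) = choice_dual d"
    by (rule structured_basis_imp_choice[OF B(1)]) blast
  have "1 / norm (choice_dual d) = 1 / sqrt sum_Max"
    using B(2) unfolding u_vec_map_sgn(1)[OF B(1)] d(2) cosine_measure_eq .
  then have "norm (choice_dual d) = sqrt sum_Max"
    by (simp only: divide_inverse mult_1 inverse_eq_iff_eq)
  moreover have "u = (1 / sqrt sum_Max) *\<^sub>R choice_dual d"
    unfolding u u_vec_map_sgn(2)[OF B(1)] d(2) B(2) cosine_measure_eq ..
  ultimately show "u \<in> cosine_vector_set D"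
    unfolding cosine_vector_set_eq using d(1) by blast
qed

end

theorem theorem3p2:
  fixes D :: "(real ^ 'n) list" and s :: nat
    and L :: "nat \<Rightarrow> (real ^ 'n) set" and DL :: "nat \<Rightarrow> (real ^ 'n) list"
  assumes "CARD('n) \<ge> 2"
    and "ospb D s"
    and "ospb_decomposition D s L DL"
  shows
    "(\<forall>B BL. structured_basis D s L BL B \<longrightarrow>
        gamma B = 1 / sqrt (\<Sum>i<s. gamma (BL i) powi (-2)) \<and>
        gamma B = 1 / sqrt (\<Sum>i<s. ones_inv_gram_ones (BL i)) \<and>
        u_vec B = (1 / sqrt (\<Sum>i<s. gamma (BL i) powi (-2))) *\<^sub>R
                    inv_transpose_ones (concat (map BL [0..<s]))) \<and>
     ((\<forall>d\<in>set D. norm d = 1) \<longrightarrow>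
        cosine_measure D =
          1 / sqrt (\<Sum>i<s. MAX d\<in>set (DL i). gamma (remove1 d (DL i)) powi (-2)) \<and>
        cosine_vector_set D =
          {u_vec B | B BL. structured_basis D s L BL B \<and> gamma B = cosine_measure D \<and>
             u_vec B = (1 / sqrt (\<Sum>i<s. gamma (BL i) powi (-2))) *\<^sub>R
                         inv_transpose_ones (concat (map BL [0..<s]))}) \<and>
     cosine_measure D =
       1 / sqrt (\<Sum>i<s. MAX d\<in>set (DL i). gamma (map sgn (remove1 d (DL i))) powi (-2)) \<and>
     cosine_vector_set D =
       {u_vec (map sgn B) | B BL.
          structured_basis D s L BL B \<and> gamma (map sgn B) = cosine_measure D \<and>
          u_vec (map sgn B) = (1 / sqrt (\<Sum>i<s. gamma (map sgn (BL i)) powi (-2))) *\<^sub>R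
                                inv_transpose_ones (map sgn (concat (map BL [0..<s])))}"
proof -
  interpret ospb_with_decomposition D s L DL
    using assms(2,3) by unfold_locales
  have formulas: "gamma B = 1 / sqrt (\<Sum>i<s. gamma (BL i) powi (-2)) \<and>
        gamma B = 1 / sqrt (\<Sum>i<s. ones_inv_gram_ones (BL i)) \<and>
        u_vec B = (1 / sqrt (\<Sum>i<s. gamma (BL i) powi (-2))) *\<^sub>R
                    inv_transpose_ones (concat (map BL [0..<s]))"
    if "structured_basis D s L BL B" for B BL
    using sum_formulas(2-4)[of B BL] that by (simp only: structured_basis_def)
  have unit: "cosine_measure D =
          1 / sqrt (\<Sum>i<s. MAX d\<in>set (DL i). gamma (remove1 d (DL i)) powi (-2)) \<and>
        cosine_vector_set D =
          {u_vec B | B BL. structured_basis D s L BL B \<and> gamma B = cosine_measure D \<and>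
             u_vec B = (1 / sqrt (\<Sum>i<s. gamma (BL i) powi (-2))) *\<^sub>R
                         inv_transpose_ones (concat (map BL [0..<s]))}"
    if norm: "\<forall>d\<in>set D. norm d = 1"
  proof (rule conjI)
    have id: "map sgn xs = xs" if "set xs \<subseteq> set D" for xs
      using that norm by (intro map_idI) (auto simp: sgn_div_norm)
    have id_remove1: "map sgn (remove1 d (DL i)) = remove1 d (DL i)" if "i < s" for i d
      using that set_D by (intro id) (auto dest: notin_set_remove1)
    have id_basis: "map sgn B = B" if "structured_basis D s L BL B" for B BL
      by (intro id structured_basis_subset[OF that])
    have "(\<Sum>i<s. MAX d\<in>set (DL i). gamma (map sgn (remove1 d (DL i))) powi (-2)) =
        (\<Sum>i<s. MAX d\<in>set (DL i). gamma (remove1 d (DL i)) powi (-2))"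
      by (intro sum.cong refl) (simp add: id_remove1)
    then show "cosine_measure D =
        1 / sqrt (\<Sum>i<s. MAX d\<in>set (DL i). gamma (remove1 d (DL i)) powi (-2))"
      unfolding cosine_measure_formula by (rule arg_cong)
    show "cosine_vector_set D =
          {u_vec B | B BL. structured_basis D s L BL B \<and> gamma B = cosine_measure D \<and>
             u_vec B = (1 / sqrt (\<Sum>i<s. gamma (BL i) powi (-2))) *\<^sub>R
                         inv_transpose_ones (concat (map BL [0..<s]))}"
      (is "_ = ?R")
    proof (intro Set.set_eqI iffI)
      fix u assume "u \<in> cosine_vector_set D"
      then obtain B BL where B: "structured_basis D s L BL B"
        "gamma (map sgn B) = cosine_measure D" "u = u_vec (map sgn B)"
        unfolding cosine_vector_set_formula by blast
      then show "u \<in> ?R"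
        unfolding id_basis[OF B(1)] using formulas[OF B(1)] by blast
    next
      fix u assume "u \<in> ?R"
      then obtain B BL where B: "structured_basis D s L BL B" "gamma B = cosine_measure D"
        "u = u_vec B"
        by blast
      then show "u \<in> cosine_vector_set D"
        unfolding cosine_vector_set_formula mem_Collect_eq
        using id_basis[OF B(1)] u_vec_map_sgn(3)[OF B(1)]
        by (intro exI[of _ B] exI[of _ BL]) (simp only: simp_thms)
    qed
  qed
  show ?thesis
    using formulas unit cosine_measure_formula cosine_vector_set_formula by blast
qed

end
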